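(* Let $f\in L_0^2(\pi)$ be smooth and monotone (increasing or decreasing), and let $\phi\in L_0^2(\pi)$ solve $-(-V'\phi'+\phi'')=f$. Let $\xi(x,y)=\frac14\phi(x)\phi(y)$ and, for $\alpha\in\mathcal{A}$, let $\Gamma_\alpha=2\alpha(x,y)\partial_x\partial_y$ and $\delta\sigma_F^2(\Gamma_\alpha)=\int_{\mathbb{R}^2}\Gamma_\alpha\xi\,\mathrm{d}\bar\pi_0$. Then $\alpha^*\equiv-1$ satisfies $\delta\sigma_F^2(\Gamma_{\alpha^*})\le\delta\sigma_F^2(\Gamma_\alpha)$ for all $\alpha\in\mathcal{A}$.
   Context: $V\in C^\infty(\mathbb{R})$ with $Z=\int_{\mathbb{R}}e^{-V}\,\mathrm{d}x<\infty$, $\pi(\mathrm{d}x)=Z^{-1}e^{-V(x)}\mathrm{d}x$, $\bar\pi_0=\pi\otimes\pi$ on $\mathbb{R}^2$, $L_0^2(\pi)=\{f\in L^2(\pi):\pi(f)=0\}$. The overdamped Langevin generator is $\mathcal{L}=-V'\partial_x+\partial_x^2$; it is assumed invertible on $L_0^2(\pi)$, i.e. for every $f\in L_0^2(\pi)$ there is $\phi\in\mathcal{D}(\mathcal{L})\cap L_0^2(\pi)$ with $-\mathcal{L}\phi=f$; $\phi$ denotes this solution. $\mathcal{A}=\{\alpha:\mathbb{R}^2\to\mathbb{R}\ \text{measurable},\ -1\le\alpha\le1\}$. The functional $\delta\sigma_F^2$ is the first-order variation, at independent coupling, of the asymptotic variance for the observable $F(x,y)=\frac12(f(x)+f(y))$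 of two coupled Langevin particles. *)

theory Defs
  imports "HOL-Analysis.Analysis"
begin

definition smooth_fun :: "(real \<Rightarrow> real) \<Rightarrow> bool" where
  "smooth_fun f \<longleftrightarrow> (\<forall>n x. ((deriv ^^ n) f) differentiable (at x))"

definition gibbs_Z :: "(real \<Rightarrow> real) \<Rightarrow> real" where
  "gibbs_Z V = (LINT x|lborel. exp (- V x))"

definition gibbs :: "(real \<Rightarrow> real) \<Rightarrow> real measure" where
  "gibbs V = density lborel (\<lambda>x. ennreal (exp (- V x) / gibbs_Z V))"

text \<open>Elements of \<open>L\<^sup>2\<close> are represented by functions; no quotient by almost-everywhere
  equality is taken.\<close>

definition L2_fun :: "real measure \<Rightarrow> (real \<Rightarrow> real) set" where
  "L2_fun M = {f \<in> borel_measurable M. integrable M (\<lambda>x. (f x)\<^sup>2)}"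

definition L2_0 :: "real measure \<Rightarrow> (real \<Rightarrow> real) set" where
  "L2_0 M = {f \<in> L2_fun M. (LINT x|M. f x) = 0}"

definition L2_tendsto :: "real measure \<Rightarrow> (nat \<Rightarrow> real \<Rightarrow> real) \<Rightarrow> (real \<Rightarrow> real) \<Rightarrow> bool" where
  "L2_tendsto M u f \<longleftrightarrow> (\<lambda>n. \<integral>\<^sup>+x. ennreal ((u n x - f x)\<^sup>2) \<partial>M) \<longlonglongrightarrow> 0"

definition langevin_op :: "(real \<Rightarrow> real) \<Rightarrow> (real \<Rightarrow> real) \<Rightarrow> real \<Rightarrow> real" where
  "langevin_op V u x = - deriv V x * deriv u x + deriv (deriv u) x"

definition test_fun :: "(real \<Rightarrow> real) \<Rightarrow> bool" where
  "test_fun u \<longleftrightarrow> smooth_fun u \<and> compact (closure {x. u x \<noteq> 0})"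

text \<open>Graph of the generator on \<open>L\<^sup>2\<close> of the Gibbs measure: the closure of the differential
  operator on compactly supported smooth functions. For smooth \<open>V\<close> on the whole line this
  operator is essentially self-adjoint, so its closure is the generator of the Langevin semigroup
  and also the maximal (distributional) realization.\<close>

definition langevin_graph :: "(real \<Rightarrow> real) \<Rightarrow> ((real \<Rightarrow> real) \<times> (real \<Rightarrow> real)) set" where
  "langevin_graph V = {(u, g). u \<in> L2_fun (gibbs V) \<and> g \<in> L2_fun (gibbs V) \<and>
     (\<exists>w. (\<forall>n. test_fun (w n)) \<and> L2_tendsto (gibbs V) w u \<and>
          L2_tendsto (gibbs V) (\<lambda>n. langevin_op V (w n)) g)}"

definition langevin_invertible :: "(real \<Rightarrow> real) \<Rightarrow> bool" where
  "langevin_invertible V \<longleftrightarrow>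
     (\<forall>f \<in> L2_0 (gibbs V). \<exists>u \<in> L2_0 (gibbs V). (u, \<lambda>x. - f x) \<in> langevin_graph V)"

definition admissible :: "(real \<times> real \<Rightarrow> real) set" where
  "admissible = {\<alpha> \<in> borel_measurable borel. \<forall>p. - 1 \<le> \<alpha> p \<and> \<alpha> p \<le> 1}"

definition partial_x :: "(real \<times> real \<Rightarrow> real) \<Rightarrow> real \<times> real \<Rightarrow> real" where
  "partial_x g = (\<lambda>(x, y). deriv (\<lambda>t. g (t, y)) x)"

definition partial_y :: "(real \<times> real \<Rightarrow> real) \<Rightarrow> real \<times> real \<Rightarrow> real" where
  "partial_y g = (\<lambda>(x, y). deriv (\<lambda>t. g (x, t)) y)"

definition coupling_op :: "(real \<times> real \<Rightarrow> real) \<Rightarrow> (real \<times> real \<Rightarrow> real) \<Rightarrow> real \<times> real \<Rightarrow> real" where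
  "coupling_op \<alpha> g p = 2 * \<alpha> p * partial_x (partial_y g) p"

definition xi :: "(real \<Rightarrow> real) \<Rightarrow> real \<times> real \<Rightarrow> real" where
  "xi \<phi> = (\<lambda>(x, y). 1 / 4 * \<phi> x * \<phi> y)"

definition delta_sigma2 ::
  "(real \<Rightarrow> real) \<Rightarrow> (real \<Rightarrow> real) \<Rightarrow> ((real \<times> real \<Rightarrow> real) \<Rightarrow> real \<times> real \<Rightarrow> real) \<Rightarrow> real" where
  "delta_sigma2 V \<phi> \<Gamma> = (LINT p|(gibbs V \<Otimes>\<^sub>M gibbs V). \<Gamma> (xi \<phi>) p)"

end

theory Submission
  imports Defs
begin

text \<open>The integrand is \<open>\<alpha>(x, y) \<phi>'(x) \<phi>'(y) / 2\<close>, so \<open>\<alpha> = - 1\<close> is pointwise optimal once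
  \<open>\<phi>'\<close> has constant sign. With the density \<open>w\<close> of \<open>\<pi>\<close>, the flux \<open>w \<phi>'\<close> has
  derivative \<open>- f w\<close>; since \<open>f\<close> is monotone, a flux of the wrong sign at one point would stay
  away from zero on a half line, which integrability of the flux forbids. Integrability of
  \<open>\<phi>'\<close> with respect to \<open>\<pi>\<close> is also what makes the integrals meaningful (a divergent one is
  \<open>0\<close> by convention); it follows from the energy estimate \<open>\<phi>' \<in> L\<^sup>2(\<pi>)\<close>, which only uses
  \<open>f, \<phi> \<in> L\<^sup>2(\<pi>)\<close>.\<close>

section \<open>Square integrability of the derivative against the weight\<close>

text \<open>Energy estimate on a half line: \<open>F\<close> is the energy \<open>\<integral> p\<^sup>2 w\<close> and \<open>Q\<close> bounds the
  cross term. If \<open>F\<close> were unbounded, the boundary term \<open>K = \<phi> w p\<close> would dominate \<open>F / 2\<close>, so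
  \<open>F\<^sup>2 / 4 \<le> K\<^sup>2 = H F'\<close> with \<open>H = \<phi>\<^sup>2 w\<close>; then \<open>(- 4 / F)' + H \<ge> 1 / H + H \<ge> 2\<close>, although both
  \<open>- 4 / F\<close> and \<open>\<integral> H\<close> stay bounded.\<close>

lemma energy_bounded_above:
  fixes w \<phi> p f F Q :: "real \<Rightarrow> real"
  assumes w: "\<And>x. 0 < w x"
    and \<phi>: "\<And>x. (\<phi> has_real_derivative p x) (at x)"
    and wp: "\<And>x. ((\<lambda>x. w x * p x) has_real_derivative - f x * w x) (at x)"
    and F: "\<And>x. (F has_real_derivative (p x)\<^sup>2 * w x) (at x)"
    and Q: "\<And>x. (Q has_real_derivative ((f x)\<^sup>2 + (\<phi> x)\<^sup>2) * w x) (at x)"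
    and B: "\<And>x. 0 \<le> x \<Longrightarrow> Q x \<le> B"
  shows "\<exists>C. \<forall>x\<ge>0. F x \<le> C"
proof (rule ccontr)
  assume unbdd: "\<not> (\<exists>C. \<forall>x\<ge>0. F x \<le> C)"
  define K where "K x = \<phi> x * (w x * p x)" for x
  have K_deriv: "(K has_real_derivative (p x)\<^sup>2 * w x - \<phi> x * f x * w x) (at x)" for x
    unfolding K_def
    by (rule derivative_eq_intros \<phi> wp refl)+ (simp add: algebra_simps power2_eq_square)
  \<comment> \<open>\<open>K - F + Q\<close> is nondecreasing and \<open>Q \<le> B\<close> on the
    half line, so \<open>C\<close> absorbs both the value at 0 and the bound
    \<open>B\<close>.\<close>
  define C where "C = \<bar>K 0 - F 0 + Q 0\<bar> + \<bar>B\<bar>"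
  have K_ge: "F x - C \<le> K x" if "0 \<le> x" for x
  proof -
    have "K 0 - F 0 + Q 0 \<le> K x - F x + Q x"
    proof (rule DERIV_nonneg_imp_nondecreasing[OF that])
      fix t
      have "0 \<le> ((f t)\<^sup>2 + (\<phi> t)\<^sup>2 - \<phi> t * f t) * w t"
      proof (intro mult_nonneg_nonneg less_imp_le[OF w])
        show "0 \<le> (f t)\<^sup>2 + (\<phi> t)\<^sup>2 - \<phi> t * f t"
          using sum_squares_bound[of "\<phi> t" "f t"] zero_le_power2[of "f t"] zero_le_power2[of "\<phi> t"]
          by linarith
      qed
      moreover have "((\<lambda>x. K x - F x + Q x) has_real_derivative
          ((f t)\<^sup>2 + (\<phi> t)\<^sup>2 - \<phi> t * f t) * w t) (at t)"
        by (rule derivative_eq_intros K_deriv F Q refl)+ (simp add: algebra_simps)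
      ultimately show "\<exists>y. ((\<lambda>x. K x - F x + Q x) has_real_derivative y) (at t) \<and> 0 \<le> y"
        by blast
    qed
    then show ?thesis using B[OF that] unfolding C_def by linarith
  qed
  \<comment> \<open>From \<open>N\<close> on, \<open>F > 2 * C\<close> gives
    \<open>F - C \<ge> F / 2\<close>; moreover \<open>F > 1\<close>, so dividing by \<open>F\<close>
    is safe.\<close>
  obtain N where N: "0 \<le> N" "2 * C + 1 < F N"
    using unbdd by (meson not_le)
  have C0: "0 \<le> C" unfolding C_def by simp
  have F_mono: "F x \<le> F y" if "x \<le> y" for x y
    using that F w by (intro DERIV_nonneg_imp_nondecreasing[OF that]) (metis less_imp_le mult_nonneg_nonneg zero_le_power2)
  \<comment> \<open>\<open>Q\<close> plays the role of the integral of \<open>H\<close>: its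
    derivative is \<open>H\<close> plus the nonnegative term \<open>(f t)\<^sup>2 * w t\<close>.
    Subtracting \<open>2 * x\<close> accounts for the growth forced by
    \<open>1 / H + H \<ge> 2\<close>.\<close>
  have lower: "- 4 / F N + Q N - 2 * N \<le> - 4 / F x + Q x - 2 * x" if "N \<le> x" for x
  proof (rule DERIV_nonneg_imp_nondecreasing[OF that])
    fix t assume t: "N \<le> t" "t \<le> x"
    define H where "H = (\<phi> t)\<^sup>2 * w t"
    have Ft: "2 * C + 1 < F t" using F_mono[OF t(1)] N by linarith
    have Fpos: "0 < F t" using Ft C0 by linarith
    have "F t / 2 \<le> K t" using K_ge[of t] t N Ft by linarith
    then have "(F t / 2)\<^sup>2 \<le> (K t)\<^sup>2" using Fpos by (intro power_mono) auto
    also have "(K t)\<^sup>2 = H * ((p t)\<^sup>2 * w t)"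
      unfolding K_def H_def by (simp add: algebra_simps power2_eq_square)
    finally have sq: "(F t)\<^sup>2 \<le> 4 * (H * ((p t)\<^sup>2 * w t))" by (simp add: power_divide)
    have "0 \<le> H" unfolding H_def using w[of t] by simp
    moreover have "H \<noteq> 0"
      using sq Fpos by auto
    ultimately have Hpos: "0 < H" by simp
    have "1 / H \<le> 4 * ((p t)\<^sup>2 * w t) / (F t)\<^sup>2"
      using sq Hpos Fpos by (simp add: field_simps)
    moreover have "2 \<le> 1 / H + H"
      using sum_squares_bound[of 1 H] Hpos by (simp add: field_simps power2_eq_square)
    moreover have "0 \<le> (f t)\<^sup>2 * w t" using w[of t] by simp
    ultimately have "0 \<le> 4 * ((p t)\<^sup>2 * w t) / (F t)\<^sup>2 + ((f t)\<^sup>2 + (\<phi> t)\<^sup>2) * w t - 2"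
      unfolding H_def[symmetric] distrib_right by linarith
    moreover have "((\<lambda>x. - 4 / F x + Q x - 2 * x) has_real_derivative
        4 * ((p t)\<^sup>2 * w t) / (F t)\<^sup>2 + ((f t)\<^sup>2 + (\<phi> t)\<^sup>2) * w t - 2) (at t)"
      using Fpos
      by (auto intro!: derivative_eq_intros F Q simp: power2_eq_square)
    ultimately show "\<exists>y. ((\<lambda>x. - 4 / F x + Q x - 2 * x) has_real_derivative y) (at t) \<and> 0 \<le> y"
      by blast
  qed
  define D where "D = - 4 / F N + Q N - 2 * N"
  \<comment> \<open>The value \<open>D\<close> at \<open>N\<close> is at most
    \<open>B - 2 * x\<close> for every later point; this choice makes \<open>2 * x\<close> exceed
    \<open>B - D\<close>.\<close>
  define x where "x = N + (\<bar>B\<bar> + \<bar>D\<bar> + 1)"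
  have "N \<le> x" unfolding x_def by linarith
  moreover have "- 4 / F x \<le> 0"
    using F_mono[OF \<open>N \<le> x\<close>] N C0 by (simp add: field_simps)
  ultimately have "D \<le> B - 2 * x"
    using lower[of x] B[of x] N unfolding D_def by linarith
  then show False
    using N(1) abs_ge_self[of B] abs_ge_zero[of B] abs_ge_minus_self[of D] unfolding x_def
    by (simp add: algebra_simps)
qed

lemma continuous_antiderivative:
  fixes h :: "real \<Rightarrow> real"
  assumes "\<And>x. isCont h x"
  obtains F where "\<And>x. (F has_real_derivative h x) (at x)"
  using einterval_antiderivative[of "-\<infinity>" "\<infinity>" h] assms
  by (auto simp: has_real_derivative_iff_has_vector_derivative)

text \<open>Each increment of \<open>F\<close> is part of the total integral of \<open>h\<close>;
  anchoring at 0 bounds \<open>F\<close> on both sides. This turns the L2 hypotheses on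
  \<open>f\<close> and \<phi> into a bound on \<open>Q\<close>.\<close>

lemma antiderivative_bounded_if_integrable:
  fixes h F :: "real \<Rightarrow> real"
  assumes F: "\<And>x. (F has_real_derivative h x) (at x)"
    and cont: "\<And>x. isCont h x" and nonneg: "\<And>x. 0 \<le> h x"
    and int: "integrable lborel h"
  obtains B where "\<And>x. \<bar>F x\<bar> \<le> B"
proof
  have bd: "F b - F a \<le> integral\<^sup>L lborel h" if "a \<le> b" for a b
  proof -
    have "F b - F a = (\<integral>x. h x * indicator {a..b} x \<partial>lborel)"
      by (rule integral_FTC_Icc_real[symmetric]) (use that F cont in auto)
    also have "\<dots> \<le> integral\<^sup>L lborel h"
      using int nonneg
      by (intro integral_mono integrable_real_mult_indicator) (auto split: split_indicator)
    finally show ?thesis .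
  qed
  have mono: "F a \<le> F b" if "a \<le> b" for a b
    using that F nonneg by (metis DERIV_nonneg_imp_nondecreasing)
  show "\<bar>F x\<bar> \<le> \<bar>F 0\<bar> + integral\<^sup>L lborel h" for x
    using bd[of 0 x] bd[of x 0] mono[of 0 x] mono[of x 0] by (cases "0 \<le> x") auto
qed

text \<open>On \<open>{- real n..real n}\<close> the integral of \<open>h\<close> is an increment of
  \<open>F\<close>, hence at most \<open>2 * B\<close>; monotone convergence passes to the whole
  line.\<close>

lemma integrable_if_antiderivative_bounded:
  fixes h F :: "real \<Rightarrow> real"
  assumes F: "\<And>x. (F has_real_derivative h x) (at x)"
    and cont: "\<And>x. isCont h x" and nonneg: "\<And>x. 0 \<le> h x"
    and bdd: "\<And>x. \<bar>F x\<bar> \<le> B"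
  shows "integrable lborel h"
proof (rule integrableI_bounded)
  have [measurable]: "h \<in> borel_measurable borel"
    using cont by (simp add: borel_measurable_continuous_onI continuous_at_imp_continuous_on)
  show "h \<in> borel_measurable lborel" by simp
  have "(\<integral>\<^sup>+x. ennreal (h x) \<partial>lborel)
      = (SUP n. \<integral>\<^sup>+x. ennreal (h x) * indicator {- real n..real n} x \<partial>lborel)"
  proof (subst nn_integral_monotone_convergence_SUP[symmetric])
    show "incseq (\<lambda>n x. ennreal (h x) * indicator {- real n..real n} x)"
      by (auto simp: incseq_def le_fun_def split: split_indicator)
    have "(SUP n. ennreal (h x) * indicator {- real n..real n} x) = ennreal (h x)" for x
    proof (rule antisym)
      obtain n :: nat where "\<bar>x\<bar> \<le> n" using real_arch_simple by blast
      then show "ennreal (h x) \<le> (SUP n. ennreal (h x) * indicator {- real n..real n} x)"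
        by (intro SUP_upper2[of n]) (auto split: split_indicator)
    qed (auto intro!: SUP_least split: split_indicator)
    then show "(\<integral>\<^sup>+x. ennreal (h x) \<partial>lborel)
      = (\<integral>\<^sup>+x. (SUP n. ennreal (h x) * indicator {- real n..real n} x) \<partial>lborel)" by simp
  qed auto
  also have "\<dots> \<le> ennreal (2 * B)"
  proof (rule SUP_least)
    fix n :: nat
    have "(\<integral>\<^sup>+x. ennreal (h x) * indicator {- real n..real n} x \<partial>lborel) = F n - F (- real n)"
      by (rule nn_integral_FTC_Icc) (use F nonneg in auto)
    also have "\<dots> \<le> ennreal (2 * B)"
      using bdd[of n] bdd[of "- real n"] by (intro ennreal_leI) linarith
    finally show "(\<integral>\<^sup>+x. ennreal (h x) * indicator {- real n..real n} x \<partial>lborel) \<le> ennreal (2 * B)" .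
  qed
  finally show "(\<integral>\<^sup>+x. ennreal (norm (h x)) \<partial>lborel) < \<infinity>"
    using nonneg by (simp add: le_less_trans[OF _ ennreal_less_top])
qed

text \<open>The half line estimate bounds the energy primitive \<open>F\<close> above on the right
  and, after reflection, below on the left. A bounded primitive of a nonnegative function means
  integrability.\<close>

lemma energy_integrable:
  fixes w \<phi> p f :: "real \<Rightarrow> real"
  assumes w: "\<And>x. 0 < w x" and cont: "\<And>x. isCont w x" "\<And>x. isCont f x" "\<And>x. isCont p x"
    and \<phi>: "\<And>x. (\<phi> has_real_derivative p x) (at x)"
    and wp: "\<And>x. ((\<lambda>x. w x * p x) has_real_derivative - f x * w x) (at x)"
    and int: "integrable lborel (\<lambda>x. (f x)\<^sup>2 * w x)" "integrable lborel (\<lambda>x. (\<phi> x)\<^sup>2 * w x)"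
  shows "integrable lborel (\<lambda>x. (p x)\<^sup>2 * w x)"
proof -
  have cont_\<phi>: "isCont \<phi> x" for x using \<phi> DERIV_isCont by blast
  obtain F where F: "\<And>x. (F has_real_derivative (p x)\<^sup>2 * w x) (at x)"
    by (rule continuous_antiderivative[of "\<lambda>x. (p x)\<^sup>2 * w x"]) (auto intro!: continuous_intros cont)
  obtain Q where Q: "\<And>x. (Q has_real_derivative ((f x)\<^sup>2 + (\<phi> x)\<^sup>2) * w x) (at x)"
    by (rule continuous_antiderivative[of "\<lambda>x. ((f x)\<^sup>2 + (\<phi> x)\<^sup>2) * w x"])
       (auto intro!: continuous_intros cont cont_\<phi>)
  obtain B where B: "\<And>x. \<bar>Q x\<bar> \<le> B"
  proof (rule antiderivative_bounded_if_integrable[OF Q])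
    show "integrable lborel (\<lambda>x. ((f x)\<^sup>2 + (\<phi> x)\<^sup>2) * w x)"
      using int by (simp add: distrib_right)
    show "0 \<le> ((f x)\<^sup>2 + (\<phi> x)\<^sup>2) * w x" for x using w[of x] by simp
  qed (auto intro!: continuous_intros cont cont_\<phi>)
  have "\<exists>C. \<forall>x\<ge>0. F x \<le> C"
  proof (rule energy_bounded_above[OF w \<phi> wp F Q])
    show "Q x \<le> B" for x using B[of x] by linarith
  qed
  then obtain C1 where C1: "\<And>x. 0 \<le> x \<Longrightarrow> F x \<le> C1" by blast
  have refl_deriv: "((\<lambda>x. g (- x)) has_real_derivative - g' (- x)) (at x)"
    if "\<And>x. (g has_real_derivative g' x) (at x)" for g g' :: "real \<Rightarrow> real" and x
    using DERIV_mirror[of g "g' (- x)" x] that by simp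
  \<comment> \<open>Reflection at 0 flips the sign of the derivative and hence of the flux, so the
    flux equation keeps its form; the reflected primitives are \<open>- F (- x)\<close> and
    \<open>- Q (- x)\<close>.\<close>
  have "\<exists>C. \<forall>x\<ge>0. - F (- x) \<le> C"
  proof (rule energy_bounded_above[where w = "\<lambda>x. w (- x)" and \<phi> = "\<lambda>x. \<phi> (- x)"
        and p = "\<lambda>x. - p (- x)" and f = "\<lambda>x. f (- x)" and Q = "\<lambda>x. - Q (- x)"])
    show "0 < w (- x)" for x by (rule w)
    show "((\<lambda>x. \<phi> (- x)) has_real_derivative - p (- x)) (at x)" for x
      by (rule refl_deriv[OF \<phi>])
    show "((\<lambda>x. w (- x) * - p (- x)) has_real_derivative - f (- x) * w (- x)) (at x)" for x
      using DERIV_minus[OF refl_deriv[OF wp, of x]] by simp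
    show "((\<lambda>x. - F (- x)) has_real_derivative (- p (- x))\<^sup>2 * w (- x)) (at x)" for x
      using DERIV_minus[OF refl_deriv[OF F, of x]] by simp
    show "((\<lambda>x. - Q (- x)) has_real_derivative ((f (- x))\<^sup>2 + (\<phi> (- x))\<^sup>2) * w (- x)) (at x)" for x
      using DERIV_minus[OF refl_deriv[OF Q, of x]] by simp
    show "- Q (- x) \<le> B" for x using B[of "- x"] by linarith
  qed
  then obtain C2 where C2: "\<And>x. 0 \<le> x \<Longrightarrow> - F (- x) \<le> C2" by blast
  have mono: "F a \<le> F b" if "a \<le> b" for a b
    using F w by (intro DERIV_nonneg_imp_nondecreasing[OF that]) (metis less_imp_le mult_nonneg_nonneg zero_le_power2)
  show ?thesis
  proof (rule integrable_if_antiderivative_bounded[OF F])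
    \<comment> \<open>Monotonicity compares \<open>F x\<close> with \<open>F 0\<close> on one side;
      \<open>C1\<close> or \<open>C2\<close> bounds the other.\<close>
    show "\<bar>F x\<bar> \<le> \<bar>F 0\<bar> + \<bar>C1\<bar> + \<bar>C2\<bar>" for x
      using C1[of x] C2[of "- x"] mono[of 0 x] mono[of x 0] by (cases "0 \<le> x") auto
    show "0 \<le> (p x)\<^sup>2 * w x" for x using w[of x] by simp
  qed (auto intro!: continuous_intros cont)
qed

section \<open>Sign of an integrable flux\<close>

text \<open>On \<open>S\<close> the absolute value of \<open>g\<close> is at least
  \<open>- c > 0\<close>, while a half line has infinite measure.\<close>

lemma not_integrable_below_const:
  fixes g :: "real \<Rightarrow> real"
  assumes int: "integrable lborel g" and "c < 0" and le: "\<And>t. t \<in> S \<Longrightarrow> g t \<le> c"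
    and S: "S = {a..} \<or> S = {..a}"
  shows False
proof -
  have [measurable]: "S \<in> sets borel" using S by auto
  \<comment> \<open>Dividing by the negative \<open>c\<close> reverses the inequality, so this
    function is at least 1 on \<open>S\<close> and dominates its indicator.\<close>
  have "integrable lborel (\<lambda>t. (1 / c) * (g t * indicator S t))"
    using int by (intro integrable_mult_right integrable_real_mult_indicator) auto
  then have "integrable lborel (indicator S :: real \<Rightarrow> real)"
  proof (rule Bochner_Integration.integrable_bound)
    show "AE t in lborel. norm (indicator S t :: real) \<le> norm (1 / c * (g t * indicator S t))"
    proof (rule AE_I2)
      show "norm (indicator S t :: real) \<le> norm (1 / c * (g t * indicator S t))" for t
        using le[of t] \<open>c < 0\<close> by (auto simp: field_simps abs_if split: split_indicator)
    qed
  qed simp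
  then have "emeasure lborel S < \<infinity>"
    by (simp add: integrable_indicator_iff)
  moreover have "emeasure lborel S = \<infinity>"
  proof (rule ccontr)
    assume fin: "emeasure lborel S \<noteq> \<infinity>"
    \<comment> \<open>\<open>S\<close> contains an interval of length \<open>m\<close>, which is
      longer than its supposed finite measure.\<close>
    define m where "m = measure lborel S + 1"
    have m: "0 < m" unfolding m_def using measure_nonneg[of lborel S] by linarith
    have "m \<le> measure lborel S"
    proof (cases "S = {a..}")
      case True
      then have "measure lborel {a..a + m} \<le> measure lborel S"
        using fin by (intro measure_mono_fmeasurable) (auto simp: fmeasurable_def top.not_eq_extremum)
      then show ?thesis using m by simp
    next
      case False
      then have "measure lborel {a - m..a} \<le> measure lborel S"
        using S fin by (intro measure_mono_fmeasurable) (auto simp: fmeasurable_def top.not_eq_extremum)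
      then show ?thesis using m by simp
    qed
    then show False unfolding m_def by simp
  qed
  ultimately show False by simp
qed

text \<open>A negative value of \<open>g\<close> would persist on a half line, on the side where \<open>f\<close> keeps its sign.\<close>

lemma integrable_flux_nonneg:
  fixes g f w :: "real \<Rightarrow> real"
  assumes int: "integrable lborel g" and w: "\<And>x. 0 < w x" and "mono f"
    and g: "\<And>x. (g has_real_derivative - f x * w x) (at x)"
  shows "0 \<le> g x"
proof (rule ccontr)
  assume neg: "\<not> 0 \<le> g x"
  show False
  \<comment> \<open>If \<open>f x \<ge> 0\<close>, then \<open>f\<close> stays nonnegative to the
    right and \<open>g\<close> does not increase there; otherwise \<open>g\<close> does not decrease
    up to \<open>x\<close> from the left.\<close>
  proof (cases "0 \<le> f x")
    case True
    have "g t \<le> g x" if "t \<in> {x..}" for t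
    proof (rule DERIV_nonpos_imp_nonincreasing[of x t g])
      fix s assume "x \<le> s"
      then have "0 \<le> f s" using True monoD[OF \<open>mono f\<close>, of x s] by linarith
      then show "\<exists>y. (g has_real_derivative y) (at s) \<and> y \<le> 0"
        using g[of s] w[of s] by (intro exI[of _ "- f s * w s"]) simp
    qed (use that in auto)
    then show False using not_integrable_below_const[OF int, of "g x" "{x..}" x] neg by simp
  next
    case False
    have "g t \<le> g x" if "t \<in> {..x}" for t
    proof (rule DERIV_nonneg_imp_nondecreasing[of t x g])
      fix s assume "s \<le> x"
      then have "f s \<le> 0" using False monoD[OF \<open>mono f\<close>, of s x] by linarith
      then show "\<exists>y. (g has_real_derivative y) (at s) \<and> 0 \<le> y"
        using g[of s] w[of s] by (intro exI[of _ "- f s * w s"]) (simp add: mult_nonpos_nonneg)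
    qed (use that in auto)
    then show False using not_integrable_below_const[OF int, of "g x" "{..x}" x] neg by simp
  qed
qed

section \<open>Product integrability and the mixed derivative\<close>

text \<open>Fubini reduces this to one factor; with \<open>p\<close> the derivative of \<phi>, the
  product dominates every coupling integrand.\<close>

lemma integrable_tensor:
  fixes p :: "real \<Rightarrow> real"
  assumes "sigma_finite_measure M" "integrable M p"
  shows "integrable (M \<Otimes>\<^sub>M M) (\<lambda>z. p (fst z) * p (snd z))"
proof -
  interpret M: sigma_finite_measure M by fact
  interpret pair_sigma_finite M M ..
  note [measurable] = borel_measurable_integrable[OF assms(2)]
  show ?thesis
    by (rule Fubini_integrable) (use assms(2) in \<open>simp_all add: abs_mult\<close>)
qed

lemma partial_xy_xi:
  assumes "\<And>x. \<phi> differentiable (at x)"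
  shows "partial_x (partial_y (xi \<phi>)) (x, y) = 1 / 4 * deriv \<phi> x * deriv \<phi> y"
proof -
  have d: "(\<phi> has_real_derivative deriv \<phi> x) (at x)" for x
    using assms[of x] by (simp add: DERIV_deriv_iff_real_differentiable)
  have [simp]: "deriv (\<lambda>t. 1 / 4 * \<phi> x * \<phi> t) y = 1 / 4 * \<phi> x * deriv \<phi> y" for x y
    by (rule DERIV_imp_deriv, rule DERIV_cmult, rule d)
  have [simp]: "deriv (\<lambda>t. 1 / 4 * \<phi> t * deriv \<phi> y) x = 1 / 4 * deriv \<phi> x * deriv \<phi> y"
    by (rule DERIV_imp_deriv, rule DERIV_cmult_right, rule DERIV_cmult, rule d)
  show ?thesis
    by (simp add: partial_x_def partial_y_def xi_def del: times_divide_eq_left)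
qed

section \<open>Optimality of the coupling -1\<close>

theorem corollary57:
  fixes V f \<phi> :: "real \<Rightarrow> real"
  assumes "smooth_fun V"
    and "integrable lborel (\<lambda>x. exp (- V x))"
    and "langevin_invertible V"
    and "f \<in> L2_0 (gibbs V)"
    and "smooth_fun f"
    and "mono f \<or> antimono f"
    and "\<phi> \<in> L2_0 (gibbs V)"
    and "\<And>x. \<phi> differentiable (at x)"
    and "\<And>x. deriv \<phi> differentiable (at x)"
    and "\<And>x. - langevin_op V \<phi> x = f x"
  shows "\<forall>\<alpha>\<in>admissible.
    delta_sigma2 V \<phi> (coupling_op (\<lambda>_. - 1)) \<le> delta_sigma2 V \<phi> (coupling_op \<alpha>)"
proof
  fix \<alpha> assume \<alpha>: "\<alpha> \<in> admissible"
  define w where "w x = exp (- V x) / gibbs_Z V" for x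
  define p where "p = deriv \<phi>"
  define M where "M = gibbs V"
  have diff: "V differentiable (at x)" "f differentiable (at x)" for x
    using assms(1,5) unfolding smooth_fun_def by (metis funpow_0)+
  have V': "(V has_real_derivative deriv V x) (at x)" for x
    using diff by (simp add: DERIV_deriv_iff_real_differentiable)
  have \<phi>': "(\<phi> has_real_derivative p x) (at x)" for x
    using assms(8) by (simp add: p_def DERIV_deriv_iff_real_differentiable)
  have p': "(p has_real_derivative deriv p x) (at x)" for x
    using assms(9) by (simp add: p_def DERIV_deriv_iff_real_differentiable)
  have cont: "isCont V x" "isCont f x" "isCont p x" for x
    using V' p' diff(2) DERIV_isCont differentiable_imp_continuous_within by blast+
  have [measurable]: "V \<in> borel_measurable borel" "p \<in> borel_measurable borel"
    using cont by (auto intro!: borel_measurable_continuous_onI continuous_at_imp_continuous_on)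
  \<comment> \<open>A vanishing integral would make the strictly positive \<open>exp (- V x)\<close>
    zero almost everywhere.\<close>
  have "gibbs_Z V \<noteq> 0"
  proof
    assume "gibbs_Z V = 0"
    then have "AE x in lborel. exp (- V x) = 0"
      using assms(2) unfolding gibbs_Z_def by (subst (asm) integral_nonneg_eq_0_iff_AE) auto
    then have "AE x in (lborel :: real measure). False" by simp
    then have "emeasure lborel (UNIV :: real set) = 0"
      using AE_iff_measurable[of UNIV "lborel :: real measure" "\<lambda>_. False"] by simp
    then show False by simp
  qed
  moreover have "0 \<le> gibbs_Z V" unfolding gibbs_Z_def by simp
  ultimately have Z: "0 < gibbs_Z V" by simp
  have w: "0 < w x" for x unfolding w_def using Z by simp
  have cont_w: "isCont w x" for x
    unfolding w_def using Z by (auto intro!: continuous_intros cont)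
  have [measurable]: "w \<in> borel_measurable borel"
    using cont_w by (auto intro!: borel_measurable_continuous_onI continuous_at_imp_continuous_on)
  have int_w: "integrable lborel w" unfolding w_def using assms(2) by simp
  have M_eq: "M = density lborel (\<lambda>x. ennreal (w x))" unfolding M_def gibbs_def w_def ..
  have sets_M [measurable_cong]: "sets M = sets borel" unfolding M_eq by simp
  have M_iff: "integrable M h \<longleftrightarrow> integrable lborel (\<lambda>x. h x * w x)"
    if "h \<in> borel_measurable M" for h :: "real \<Rightarrow> real"
    using that w unfolding M_eq
    by (subst integrable_density) (auto simp: less_imp_le mult.commute)
  have L2: "integrable lborel (\<lambda>x. (h x)\<^sup>2 * w x)" if "h \<in> L2_0 M" for h
  proof -
    have "h \<in> borel_measurable M" "integrable M (\<lambda>x. (h x)\<^sup>2)"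
      using that unfolding L2_0_def L2_fun_def by auto
    then show ?thesis using M_iff[of "\<lambda>x. (h x)\<^sup>2"] by simp
  qed
  \<comment> \<open>Divergence form of the Poisson equation: \<open>w' = - V' w\<close> turns
    \<open>p' - V' p = - f\<close> into \<open>(w p)' = - f w\<close>.\<close>
  have wp: "((\<lambda>x. w x * p x) has_real_derivative - f x * w x) (at x)" for x
  proof -
    have f: "f x = deriv V x * p x - deriv p x"
      using assms(10)[of x] unfolding langevin_op_def p_def by simp
    have w': "(w has_real_derivative - deriv V x * w x) (at x)"
      unfolding w_def using Z by (auto intro!: derivative_eq_intros V')
    show ?thesis
      using DERIV_mult[OF w' p'[of x]] by (simp add: f algebra_simps)
  qed
  have energy: "integrable lborel (\<lambda>x. (p x)\<^sup>2 * w x)"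
    by (rule energy_integrable[OF w cont_w cont(2,3) \<phi>' wp])
       (use assms(4,7) L2 in \<open>auto simp: M_def\<close>)
  \<comment> \<open>Since \<open>w\<close> is integrable,
    \<open>\<bar>p\<bar> \<le> p\<^sup>2 + 1\<close> passes from finite energy to an integrable
    flux.\<close>
  have flux: "integrable lborel (\<lambda>x. w x * p x)"
  proof (rule Bochner_Integration.integrable_bound)
    show "integrable lborel (\<lambda>x. (p x)\<^sup>2 * w x + w x)" using energy int_w by simp
    show "AE x in lborel. norm (w x * p x) \<le> norm ((p x)\<^sup>2 * w x + w x)"
    proof (rule AE_I2)
      fix x
      have "\<bar>p x\<bar> \<le> (p x)\<^sup>2 + 1"
        using sum_squares_bound[of "\<bar>p x\<bar>" 1] zero_le_power2[of "p x"] by simp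
      then have "w x * \<bar>p x\<bar> \<le> w x * ((p x)\<^sup>2 + 1)" using w[of x] by (intro mult_left_mono) auto
      then show "norm (w x * p x) \<le> norm ((p x)\<^sup>2 * w x + w x)"
        using w[of x] by (simp add: abs_mult algebra_simps)
    qed
  qed simp
  have int_p: "integrable M p" using flux by (subst M_iff) (auto simp: mult.commute)
  \<comment> \<open>Only the product enters the integrand, so both monotonicity cases suffice; the
    decreasing one follows by negating \<open>f\<close> and the flux together.\<close>
  have sign: "0 \<le> p x * p y" for x y
    using assms(6)
  proof
    assume "mono f"
    then have "0 \<le> w x * p x" for x
      by (rule integrable_flux_nonneg[OF flux w _ wp])
    then have "0 \<le> p x" for x using w by (meson not_le mult_pos_neg)
    then show ?thesis by simp
  next
    assume anti: "antimono f"
    have "0 \<le> - (w x * p x)" for x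
    proof (rule integrable_flux_nonneg[where f = "\<lambda>x. - f x" and w = w
          and g = "\<lambda>x. - (w x * p x)"])
      show "integrable lborel (\<lambda>x. - (w x * p x))" using flux by simp
      show "mono (\<lambda>x. - f x)" using anti by (auto simp: mono_def antimono_def)
      show "((\<lambda>x. - (w x * p x)) has_real_derivative - (- f x) * w x) (at x)" for x
        using DERIV_minus[OF wp[of x]] by simp
    qed (rule w)
    then have "p x \<le> 0" for x using w by (meson neg_0_le_iff_le not_le mult_pos_pos)
    then show ?thesis by (simp add: mult_nonpos_nonpos)
  qed
  have sf: "sigma_finite_measure M"
  proof -
    have "finite_measure M"
      by (rule finite_measureI)
         (use int_w w in \<open>simp add: M_eq emeasure_density less_imp_le nn_integral_eq_integral\<close>)
    then show ?thesis by (simp add: finite_measure_def)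
  qed
  have coupling: "coupling_op \<beta> (xi \<phi>) z = \<beta> z * (p (fst z) * p (snd z)) / 2" for \<beta> z
    by (cases z) (simp add: coupling_op_def partial_xy_xi[OF assms(8)] p_def)
  \<comment> \<open>Admissible functions are Borel on the plane, whereas the integral uses the
    product sigma-algebra; the two agree.\<close>
  have sets_MM: "sets (M \<Otimes>\<^sub>M M) = sets (borel :: (real \<times> real) measure)"
    unfolding borel_prod[symmetric] by (intro sets_pair_measure_cong sets_M)
  \<comment> \<open>Domination by \<open>\<bar>p (fst z) * p (snd z)\<bar>\<close> works because
    \<open>\<bar>\<beta>\<bar> \<le> 1\<close> and the prefactor is \<open>1 / 2\<close>.\<close>
  have int_coupling: "integrable (M \<Otimes>\<^sub>M M) (coupling_op \<beta> (xi \<phi>))" if "\<beta> \<in> admissible" for \<beta>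
  proof (rule Bochner_Integration.integrable_bound[OF integrable_tensor[OF sf int_p]])
    have "\<beta> \<in> borel_measurable (M \<Otimes>\<^sub>M M)"
      using that unfolding admissible_def measurable_cong_sets[OF sets_MM refl] by simp
    then show "coupling_op \<beta> (xi \<phi>) \<in> borel_measurable (M \<Otimes>\<^sub>M M)"
      unfolding coupling[abs_def] by measurable
    have "- 1 \<le> \<beta> z \<and> \<beta> z \<le> 1" for z using that unfolding admissible_def by blast
    then have "\<bar>\<beta> z\<bar> \<le> 1" for z by (simp add: abs_le_iff minus_le_iff[of "\<beta> z"])
    then have "\<bar>\<beta> z\<bar> * \<bar>p (fst z) * p (snd z)\<bar> \<le> 1 * \<bar>p (fst z) * p (snd z)\<bar>" for z
      by (intro mult_right_mono) auto
    moreover have "a / 2 \<le> b" if "a \<le> 1 * b" "0 \<le> b" for a b :: real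
      using that by linarith
    ultimately have "\<bar>\<beta> z\<bar> * \<bar>p (fst z) * p (snd z)\<bar> / 2 \<le> \<bar>p (fst z) * p (snd z)\<bar>" for z
      by (meson abs_ge_zero)
    then show "AE z in M \<Otimes>\<^sub>M M. norm (coupling_op \<beta> (xi \<phi>) z) \<le> norm (p (fst z) * p (snd z))"
      unfolding coupling by (simp add: abs_mult)
  qed
  show "delta_sigma2 V \<phi> (coupling_op (\<lambda>_. - 1)) \<le> delta_sigma2 V \<phi> (coupling_op \<alpha>)"
    unfolding delta_sigma2_def M_def[symmetric]
  proof (rule integral_mono)
    show "integrable (M \<Otimes>\<^sub>M M) (coupling_op (\<lambda>_. - 1) (xi \<phi>))"
      by (rule int_coupling) (simp add: admissible_def)
    show "integrable (M \<Otimes>\<^sub>M M) (coupling_op \<alpha> (xi \<phi>))"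
      by (rule int_coupling) fact
    show "coupling_op (\<lambda>_. - 1) (xi \<phi>) z \<le> coupling_op \<alpha> (xi \<phi>) z" for z
    proof -
      have "- 1 \<le> \<alpha> z" using \<alpha> unfolding admissible_def by blast
      from mult_right_mono[OF this sign] show ?thesis
        unfolding coupling by (intro divide_right_mono) auto
    qed
  qed
qed

end
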